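(* Fix any temperature $T>0$. Then for any boundary condition $\xi\in\{1,0,-1\}^{\mathbb Z^2}$: (i) if $\epsilon=\epsilon(N)>0$ satisfies $\epsilon(N)\ll N^{-1}$, then $\Vert \mu^{\xi,\epsilon h}_{T,\Lambda_N}-\mu^{\xi,0}_{T,\Lambda_N}\Vert_{\mathrm{TV}}\to 0$ in $\mathbb P$-probability as $N\to\infty$; (ii) if $\epsilon=\epsilon(N)>0$ satisfies $\epsilon(N)\gg N^{-1}$, then $\Vert \mu^{\xi,\epsilon h}_{T,\Lambda_N}-\mu^{\xi,0}_{T,\Lambda_N}\Vert_{\mathrm{TV}}\to 1$ in $\mathbb P$-probability as $N\to\infty$.
   Context: Write $a(N)\ll b(N)$ if $\lim_{N\to\infty}a(N)/b(N)=0$ and $a(N)\gg b(N)$ if $\lim_{N\to\infty}a(N)/b(N)=\infty$. Vertices $u,v\in\mathbb Z^2$ are adjacent, $u\sim v$, if their $\ell_1$-distance is $1$. $\Lambda_N=[-N,N]^2\cap\mathbb Z^2$. The external field $h=\{h_x:x\in\mathbb Z^2\}$ consists of i.i.d. standard normal variables with law $\mathbb P$. For a finite $V\subset\mathbb Z^2$, a boundary condition $\xi\in\{1,0,-1\}^{\mathbb Z^2}$ and $\epsilon\ge 0$, the random field Ising Hamiltonian on $\Sigma=\{-1,1\}^V$ is $$H_{T,V}^{\xi,\epsilon h}(\sigma)=-\Big(\sum_{\{u,v\}\subset V,\ u\sim v}\sigma_u\sigma_v+\sum_{u\in V,\ v\notin V,\ u\sim v}\sigma_u\xi_v+\sum_{u\in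 V}\epsilon h_u\sigma_u\Big),$$ where the first sum runs over edges (unordered pairs). The random field Ising measure at temperature $T>0$ is the probability measure $\mu_{T,V}^{\xi,\epsilon h}(\sigma)\propto \exp\big(-\tfrac1T H_{T,V}^{\xi,\epsilon h}(\sigma)\big)$ on $\Sigma$ (a random measure depending on $h$); $\mu_{T,V}^{\xi,0}$ is the case $\epsilon=0$ (no field). The total variation distance of discrete probability measures is $\Vert\mu-\nu\Vert_{\mathrm{TV}}=\frac12\sum_\omega|\mu(\omega)-\nu(\omega)|$. *)

theory Defs
  imports "HOL-Probability.Probability"
begin

type_synonym site = "int \<times> int"

definition adj :: "site \<Rightarrow> site \<Rightarrow> bool" (infix "\<sim>\<^sub>1" 50) where
  "u \<sim>\<^sub>1 v \<longleftrightarrow> \<bar>fst u - fst v\<bar> + \<bar>snd u - snd v\<bar> = 1"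

definition lattice_box :: "nat \<Rightarrow> site set" where
  "lattice_box N = {- int N..int N} \<times> {- int N..int N}"

text \<open>Edges inside \<open>V\<close> are unordered pairs, so each bond enters the Hamiltonian once.\<close>

definition inner_edges :: "site set \<Rightarrow> site set set" where
  "inner_edges V = {{u, v} | u v. u \<in> V \<and> v \<in> V \<and> u \<sim>\<^sub>1 v}"

definition boundary_edges :: "site set \<Rightarrow> (site \<times> site) set" where
  "boundary_edges V = {(u, v). u \<in> V \<and> v \<notin> V \<and> u \<sim>\<^sub>1 v}"

text \<open>Configurations on \<open>V\<close> are extensional functions (value \<open>undefined\<close> off \<open>V\<close>),
  so that they are in bijection with \<open>{-1, 1}\<close>-valued functions on \<open>V\<close>.\<close>

definition spins :: "site set \<Rightarrow> (site \<Rightarrow> real) set" where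
  "spins V = (V \<rightarrow>\<^sub>E {-1, 1})"

text \<open>The argument \<open>\<eta>\<close> is the full external field; the random field model is the case
  \<open>\<eta> = \<epsilon> h\<close>. For an edge \<open>e = {u, v}\<close> the product over \<open>e\<close> is \<open>\<sigma> u * \<sigma> v\<close>.\<close>

definition hamiltonian ::
  "site set \<Rightarrow> (site \<Rightarrow> real) \<Rightarrow> (site \<Rightarrow> real) \<Rightarrow> (site \<Rightarrow> real) \<Rightarrow> real" where
  "hamiltonian V \<xi> \<eta> \<sigma> =
     - ((\<Sum>e\<in>inner_edges V. \<Prod>x\<in>e. \<sigma> x)
        + (\<Sum>(u, v)\<in>boundary_edges V. \<sigma> u * \<xi> v)
        + (\<Sum>u\<in>V. \<eta> u * \<sigma> u))"

definition partition_function ::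
  "real \<Rightarrow> site set \<Rightarrow> (site \<Rightarrow> real) \<Rightarrow> (site \<Rightarrow> real) \<Rightarrow> real" where
  "partition_function T V \<xi> \<eta> = (\<Sum>\<sigma>\<in>spins V. exp (- (1 / T) * hamiltonian V \<xi> \<eta> \<sigma>))"

definition ising_measure ::
  "real \<Rightarrow> site set \<Rightarrow> (site \<Rightarrow> real) \<Rightarrow> (site \<Rightarrow> real) \<Rightarrow> (site \<Rightarrow> real) pmf" where
  "ising_measure T V \<xi> \<eta> = embed_pmf (\<lambda>\<sigma>. if \<sigma> \<in> spins V
     then exp (- (1 / T) * hamiltonian V \<xi> \<eta> \<sigma>) / partition_function T V \<xi> \<eta> else 0)"

definition tv_dist :: "'a pmf \<Rightarrow> 'a pmf \<Rightarrow> real" where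
  "tv_dist p q = 1 / 2 * (\<Sum>\<^sub>\<infinity>\<omega>\<in>UNIV. \<bar>pmf p \<omega> - pmf q \<omega>\<bar>)"

text \<open>Measurability is part of the definition because \<^const>\<open>measure\<close> is \<open>0\<close> on
  non-measurable sets.\<close>

definition tendsto_in_prob :: "'w measure \<Rightarrow> (nat \<Rightarrow> 'w \<Rightarrow> real) \<Rightarrow> real \<Rightarrow> bool" where
  "tendsto_in_prob M X c \<longleftrightarrow>
     (\<forall>N. X N \<in> borel_measurable M) \<and>
     (\<forall>\<delta>>0. (\<lambda>N. measure M {w \<in> space M. \<bar>X N w - c\<bar> > \<delta>}) \<longlonglongrightarrow> 0)"

definition iid_std_normal :: "'w measure \<Rightarrow> ('i \<Rightarrow> 'w \<Rightarrow> real) \<Rightarrow> bool" where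
  "iid_std_normal M h \<longleftrightarrow>
     prob_space.indep_vars M (\<lambda>_. borel) h UNIV \<and>
     (\<forall>x. distributed M lborel (h x) std_normal_density)"

lemma finite_spins: "finite V \<Longrightarrow> finite (spins V)"
  by (simp add: spins_def finite_PiE)

lemma partition_function_pos:
  assumes "finite V"
  shows "partition_function T V \<xi> \<eta> > 0"
proof -
  have "spins V \<noteq> {}"
    by (simp add: spins_def PiE_eq_empty_iff)
  then show ?thesis
    unfolding partition_function_def using finite_spins[OF assms] by (intro sum_pos) auto
qed

lemma pmf_ising_measure:
  assumes "finite V"
  shows "pmf (ising_measure T V \<xi> \<eta>) \<sigma> = (if \<sigma> \<in> spins V
     then exp (- (1 / T) * hamiltonian V \<xi> \<eta> \<sigma>) / partition_function T V \<xi> \<eta> else 0)"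
proof -
  define f where "f = (\<lambda>\<sigma>. if \<sigma> \<in> spins V
     then exp (- (1 / T) * hamiltonian V \<xi> \<eta> \<sigma>) / partition_function T V \<xi> \<eta> else 0)"
  have Z: "partition_function T V \<xi> \<eta> > 0"
    by (rule partition_function_pos[OF assms])
  have nonneg: "f \<sigma> \<ge> 0" for \<sigma>
    using Z by (simp add: f_def)
  have "(\<integral>\<^sup>+\<sigma>. ennreal (f \<sigma>) \<partial>count_space UNIV) = (\<Sum>\<sigma>\<in>spins V. ennreal (f \<sigma>))"
    by (rule nn_integral_count_space') (auto simp: f_def finite_spins[OF assms])
  also have "\<dots> = ennreal (\<Sum>\<sigma>\<in>spins V. f \<sigma>)"
    by (rule sum_ennreal) (rule nonneg)
  also have "(\<Sum>\<sigma>\<in>spins V. f \<sigma>) =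
      (\<Sum>\<sigma>\<in>spins V. exp (- (1 / T) * hamiltonian V \<xi> \<eta> \<sigma>)) / partition_function T V \<xi> \<eta>"
    unfolding sum_divide_distrib by (rule sum.cong) (simp_all add: f_def)
  also have "\<dots> = 1"
    using Z by (simp add: partition_function_def)
  finally have "pmf (embed_pmf f) \<sigma> = f \<sigma>"
    using nonneg by (intro pmf_embed_pmf) auto
  then show ?thesis
    by (simp add: ising_measure_def f_def)
qed

end

theory Submission
  imports Defs
begin

text \<open>
  Write \<open>\<beta> = 1 / T\<close>, \<open>t = \<beta> \<epsilon>\<close>, \<open>n = |\<Lambda>\<^sub>N| = (2N + 1)\<^sup>2\<close>, and let \<open>\<mu>\<close> be the measure without field. The random
  field measure is the exponential tilt of \<open>\<mu>\<close> by \<open>exp (t h \<cdot> \<sigma>)\<close>. Both regimes are settled by a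
  first moment over the field \<open>h\<close> of an explicit upper bound for the squared distance to the limit
  (\<open>tendsto_in_prob_if_second_moment\<close>); neither uses how the correlations of \<open>\<mu>\<close> decay, which is why the
  threshold \<open>1 / N\<close> is the same at every temperature and for every boundary condition.

  Weak field. Normalise the tilt by its mean over \<open>h\<close>, \<open>W \<sigma> = exp (t h \<cdot> \<sigma> - t\<^sup>2 n / 2)\<close>. The law of
  \<open>h \<cdot> \<sigma>\<close> is \<open>N(0, n)\<close> for every \<open>\<sigma>\<close>, so \<open>W \<sigma>\<close> has mean \<open>1\<close> and variance \<open>exp (t\<^sup>2 n) - 1\<close>
  (\<open>normalised_tilt_variance\<close>). The total variation distance is at most the \<open>\<mu>\<close>-average of
  \<open>|W - 1|\<close> (\<open>tv_dist_ising_small_field\<close>), and \<open>t\<^sup>2 n \<rightarrow> 0\<close> exactly when \<open>\<epsilon> N \<rightarrow> 0\<close>.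

  Strong field. One minus the total variation distance is at most the Hellinger affinity
  \<open>\<Sum>\<sigma>. sqrt (p \<sigma> q \<sigma>)\<close>, which for the two Gibbs measures equals \<open>Z(\<eta>/2) / sqrt (Z(\<eta>) Z(0))\<close>, where \<open>Z\<close> is
  the partition function in terms of the field \<open>\<eta> = \<epsilon> h\<close>. The sites with two even coordinates are
  pairwise non-adjacent, so given all other spins the spins there are independent, and summing them
  out turns \<open>Z\<close> into a sum of products of hyperbolic cosines (\<open>partition_function_integrate_out\<close>).
  At such a site \<open>u\<close> the affinity of the two conditional laws is bounded away from \<open>1\<close> in terms of
  \<open>\<beta> \<eta> u\<close> alone, because the neighbours act by a field of size at most \<open>4\<close> (\<open>cosh_midpoint_le\<close>). The
  Cauchy-Schwarz inequality over the other spins then bounds the squared affinity by a product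
  of independent factors, one for each of at least \<open>N\<^sup>2\<close> sites
  (\<open>partition_function_midpoint_le\<close>). Each factor has mean at most
  \<open>1 - \<kappa> t\<^sup>2 / (4 + t\<^sup>2)\<close> for a constant \<open>\<kappa> > 0\<close>, and the product of the means tends to \<open>0\<close> because
  \<open>N\<^sup>2 t\<^sup>2 / (4 + t\<^sup>2) \<rightarrow> \<infinity>\<close> when \<open>\<epsilon> N \<rightarrow> \<infinity>\<close>.
\<close>

section \<open>Summing out the spins on an independent set of sites\<close>

definition local_field :: "site set \<Rightarrow> (site \<Rightarrow> real) \<Rightarrow> (site \<Rightarrow> real) \<Rightarrow> site \<Rightarrow> real" where
  "local_field V \<xi> \<sigma> u = (\<Sum>v | u \<sim>\<^sub>1 v. if v \<in> V then \<sigma> v else \<xi> v)"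

text \<open>The part of minus the Hamiltonian that does not involve the spins on \<open>S\<close>.\<close>

definition rest_exponent ::
  "site set \<Rightarrow> site set \<Rightarrow> (site \<Rightarrow> real) \<Rightarrow> (site \<Rightarrow> real) \<Rightarrow> (site \<Rightarrow> real) \<Rightarrow> real" where
  "rest_exponent V S \<xi> \<eta> \<sigma> =
     (\<Sum>e\<in>inner_edges (V - S). \<Prod>x\<in>e. \<sigma> x)
     + (\<Sum>(u, v)\<in>{(u, v) \<in> boundary_edges V. u \<notin> S}. \<sigma> u * \<xi> v)
     + (\<Sum>u\<in>V - S. \<eta> u * \<sigma> u)"

lemma neighbours_eq:
  "{v. u \<sim>\<^sub>1 v} = {(fst u + 1, snd u), (fst u - 1, snd u), (fst u, snd u + 1), (fst u, snd u - 1)}"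
  by (cases u) (auto simp: adj_def abs_if split: if_splits)

lemma finite_neighbours: "finite {v. u \<sim>\<^sub>1 v}"
  unfolding neighbours_eq by simp

lemma card_neighbours_le: "card {v. u \<sim>\<^sub>1 v} \<le> 4"
  unfolding neighbours_eq by (auto simp: card_insert_if)

lemma adj_sym: "u \<sim>\<^sub>1 v \<Longrightarrow> v \<sim>\<^sub>1 u"
  by (auto simp: adj_def)

lemma adj_irrefl: "\<not> u \<sim>\<^sub>1 u"
  by (auto simp: adj_def)

lemma finite_inner_edges: "finite V \<Longrightarrow> finite (inner_edges V)"
  by (rule finite_subset[of _ "Pow V"]) (auto simp: inner_edges_def)

lemma finite_boundary_edges:
  assumes "finite V" shows "finite (boundary_edges V)"
proof -
  have "boundary_edges V \<subseteq> Sigma V (\<lambda>u. {v. u \<sim>\<^sub>1 v})"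
    by (auto simp: boundary_edges_def)
  then show ?thesis
    by (rule finite_subset) (auto simp: assms finite_neighbours)
qed

lemma abs_local_field_le:
  assumes "\<And>v. v \<in> V \<Longrightarrow> \<bar>\<sigma> v\<bar> \<le> 1" and "\<And>v. \<bar>\<xi> v\<bar> \<le> 1"
  shows "\<bar>local_field V \<xi> \<sigma> u\<bar> \<le> 4"
proof -
  have "\<bar>local_field V \<xi> \<sigma> u\<bar> \<le> (\<Sum>v | u \<sim>\<^sub>1 v. \<bar>if v \<in> V then \<sigma> v else \<xi> v\<bar>)"
    unfolding local_field_def by (rule sum_abs)
  also have "\<dots> \<le> (\<Sum>v | u \<sim>\<^sub>1 v. 1)"
    using assms by (intro sum_mono) auto
  also have "\<dots> \<le> 4"
    using card_neighbours_le[of u] by simp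
  finally show ?thesis .
qed

text \<open>When no two sites of \<open>S\<close> are adjacent, each bond meets \<open>S\<close> in at most one end, so the Hamiltonian
  is affine in each spin of \<open>S\<close> with a coefficient that depends on the spins off \<open>S\<close> only.\<close>

lemma hamiltonian_split:
  assumes "finite V" and "S \<subseteq> V" and indep: "\<forall>u\<in>S. \<forall>v\<in>S. \<not> u \<sim>\<^sub>1 v"
  shows "hamiltonian V \<xi> \<eta> \<sigma> =
    - (rest_exponent V S \<xi> \<eta> \<sigma> + (\<Sum>u\<in>S. \<sigma> u * (local_field V \<xi> \<sigma> u + \<eta> u)))"
proof -
  have finS: "finite S" using assms finite_subset by blast
  let ?N = "\<lambda>u. {v \<in> V. u \<sim>\<^sub>1 v}" and ?X = "\<lambda>u. {v. v \<notin> V \<and> u \<sim>\<^sub>1 v}"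
  have finX: "finite (?X u)" for u
    by (rule finite_subset[OF _ finite_neighbours[of u]]) auto
  \<comment> \<open>Independence of \<open>S\<close> makes \<open>(u, v)\<close> with \<open>u \<in> S\<close> the unique orientation of a bond that meets \<open>S\<close>.\<close>
  have edges: "inner_edges V = inner_edges (V - S) \<union> (\<lambda>(u, v). {u, v}) ` Sigma S ?N"
  proof (intro equalityI subsetI)
    fix e assume "e \<in> inner_edges V"
    then obtain u v where e: "e = {u, v}" "u \<in> V" "v \<in> V" "u \<sim>\<^sub>1 v"
      by (auto simp: inner_edges_def)
    consider "u \<in> S" | "v \<in> S" | "u \<notin> S" "v \<notin> S" by blast
    then show "e \<in> inner_edges (V - S) \<union> (\<lambda>(u, v). {u, v}) ` Sigma S ?N"
    proof cases
      case 1
      then show ?thesis using e by (intro UnI2 image_eqI[of _ _ "(u, v)"]) auto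
    next
      case 2
      then show ?thesis using e adj_sym[of u v] by (intro UnI2 image_eqI[of _ _ "(v, u)"]) auto
    next
      case 3
      then show ?thesis using e unfolding inner_edges_def by blast
    qed
  next
    fix e assume "e \<in> inner_edges (V - S) \<union> (\<lambda>(u, v). {u, v}) ` Sigma S ?N"
    then consider "e \<in> inner_edges (V - S)"
      | u v where "e = {u, v}" "u \<in> S" "v \<in> V" "u \<sim>\<^sub>1 v" by auto
    then show "e \<in> inner_edges V"
      using \<open>S \<subseteq> V\<close> unfolding inner_edges_def by cases blast+
  qed
  have disj: "inner_edges (V - S) \<inter> (\<lambda>(u, v). {u, v}) ` Sigma S ?N = {}"
    by (auto simp: inner_edges_def doubleton_eq_iff)
  have inj: "inj_on (\<lambda>(u, v). {u, v}) (Sigma S ?N)"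
    using indep by (auto simp: inj_on_def doubleton_eq_iff)
  have "(\<Sum>e\<in>inner_edges V. \<Prod>x\<in>e. \<sigma> x) =
      (\<Sum>e\<in>inner_edges (V - S). \<Prod>x\<in>e. \<sigma> x)
      + (\<Sum>e\<in>(\<lambda>(u, v). {u, v}) ` Sigma S ?N. \<Prod>x\<in>e. \<sigma> x)"
    unfolding edges using assms(1) finS disj
    by (intro sum.union_disjoint finite_inner_edges finite_imageI finite_SigmaI) auto
  also have "(\<Sum>e\<in>(\<lambda>(u, v). {u, v}) ` Sigma S ?N. \<Prod>x\<in>e. \<sigma> x)
      = (\<Sum>(u, v)\<in>Sigma S ?N. \<sigma> u * \<sigma> v)"
    unfolding sum.reindex[OF inj]
  proof (intro sum.cong refl)
    fix p assume "p \<in> Sigma S ?N"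
    then obtain u v where "p = (u, v)" "u \<sim>\<^sub>1 v" by auto
    moreover have "u \<noteq> v" using \<open>u \<sim>\<^sub>1 v\<close> adj_irrefl by metis
    ultimately show "((\<lambda>e. \<Prod>x\<in>e. \<sigma> x) \<circ> (\<lambda>(u, v). {u, v})) p = (case p of (u, v) \<Rightarrow> \<sigma> u * \<sigma> v)"
      by simp
  qed
  also have "\<dots> = (\<Sum>u\<in>S. \<Sum>v\<in>?N u. \<sigma> u * \<sigma> v)"
    using assms(1) finS by (intro sum.Sigma[symmetric]) auto
  finally have inner: "(\<Sum>e\<in>inner_edges V. \<Prod>x\<in>e. \<sigma> x) =
      (\<Sum>e\<in>inner_edges (V - S). \<Prod>x\<in>e. \<sigma> x) + (\<Sum>u\<in>S. \<Sum>v\<in>?N u. \<sigma> u * \<sigma> v)" .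
  have bsplit: "boundary_edges V = {(u, v) \<in> boundary_edges V. u \<notin> S} \<union> Sigma S ?X"
    using \<open>S \<subseteq> V\<close> by (auto simp: boundary_edges_def)
  have "(\<Sum>(u, v)\<in>boundary_edges V. \<sigma> u * \<xi> v) =
      (\<Sum>(u, v)\<in>{(u, v) \<in> boundary_edges V. u \<notin> S}. \<sigma> u * \<xi> v)
      + (\<Sum>(u, v)\<in>Sigma S ?X. \<sigma> u * \<xi> v)"
    by (subst bsplit, rule sum.union_disjoint)
       (use finS finX in \<open>auto intro: finite_subset[OF _ finite_boundary_edges[OF assms(1)]]\<close>)
  also have "(\<Sum>(u, v)\<in>Sigma S ?X. \<sigma> u * \<xi> v) = (\<Sum>u\<in>S. \<Sum>v\<in>?X u. \<sigma> u * \<xi> v)"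
    using finX finS by (intro sum.Sigma[symmetric]) auto
  finally have boundary: "(\<Sum>(u, v)\<in>boundary_edges V. \<sigma> u * \<xi> v) =
      (\<Sum>(u, v)\<in>{(u, v) \<in> boundary_edges V. u \<notin> S}. \<sigma> u * \<xi> v)
      + (\<Sum>u\<in>S. \<Sum>v\<in>?X u. \<sigma> u * \<xi> v)" .
  have field: "(\<Sum>u\<in>V. \<eta> u * \<sigma> u) = (\<Sum>u\<in>V - S. \<eta> u * \<sigma> u) + (\<Sum>u\<in>S. \<eta> u * \<sigma> u)"
    by (rule sum.subset_diff) (use assms in auto)
  have local: "\<sigma> u * local_field V \<xi> \<sigma> u =
      (\<Sum>v\<in>?N u. \<sigma> u * \<sigma> v) + (\<Sum>v\<in>?X u. \<sigma> u * \<xi> v)" for u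
  proof -
    have "{v. u \<sim>\<^sub>1 v} \<inter> V = ?N u" "{v. u \<sim>\<^sub>1 v} - V = ?X u" by auto
    then show ?thesis
      unfolding local_field_def by (simp add: sum.If_cases finite_neighbours sum_distrib_left
          distrib_left Collect_neg_eq[symmetric] Diff_eq Collect_mem_eq)
  qed
  show ?thesis
    unfolding hamiltonian_def rest_exponent_def inner boundary field
    by (simp add: distrib_left local sum.distrib algebra_simps)
qed

lemma rest_exponent_cong:
  assumes "\<And>x. x \<in> V - S \<Longrightarrow> \<sigma> x = \<tau> x"
  shows "rest_exponent V S \<xi> \<eta> \<sigma> = rest_exponent V S \<xi> \<eta> \<tau>"
proof -
  have "(\<Prod>x\<in>e. \<sigma> x) = (\<Prod>x\<in>e. \<tau> x)" if "e \<in> inner_edges (V - S)" for e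
    using that assms by (intro prod.cong) (auto simp: inner_edges_def)
  moreover have "\<sigma> u = \<tau> u" if "(u, v) \<in> boundary_edges V" "u \<notin> S" for u v
    using that assms by (auto simp: boundary_edges_def)
  ultimately show ?thesis
    unfolding rest_exponent_def using assms
    by (intro arg_cong2[where f = "(+)"] sum.cong) auto
qed

lemma local_field_cong:
  assumes "\<And>x. x \<in> V - S \<Longrightarrow> \<sigma> x = \<tau> x" and "\<And>v. v \<in> S \<Longrightarrow> \<not> u \<sim>\<^sub>1 v"
  shows "local_field V \<xi> \<sigma> u = local_field V \<xi> \<tau> u"
  unfolding local_field_def using assms by (intro sum.cong) auto

lemma sum_spins_split:
  assumes "S \<subseteq> V"
  shows "(\<Sum>\<sigma>\<in>spins V. f \<sigma>) =
    (\<Sum>\<tau>\<in>spins (V - S). \<Sum>s\<in>spins S. f (merge (V - S) S (\<tau>, s)))"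
proof -
  have V: "V = (V - S) \<union> S" using assms by blast
  have "(\<Sum>\<sigma>\<in>spins V. f \<sigma>) =
      (\<Sum>(\<tau>, s)\<in>spins (V - S) \<times> spins S. f (merge (V - S) S (\<tau>, s)))"
  proof (rule sum.reindex_bij_witness[where i = "merge (V - S) S"
        and j = "\<lambda>\<sigma>. (restrict \<sigma> (V - S), restrict \<sigma> S)"])
    fix \<sigma> assume "\<sigma> \<in> spins V"
    then show "merge (V - S) S (restrict \<sigma> (V - S), restrict \<sigma> S) = \<sigma>"
      using assms by (fastforce simp: spins_def merge_def PiE_iff extensional_def fun_eq_iff)
  next
    fix \<sigma> assume "\<sigma> \<in> spins V"
    then show "(restrict \<sigma> (V - S), restrict \<sigma> S) \<in> spins (V - S) \<times> spins S"
      using assms by (auto simp: spins_def PiE_iff)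
  next
    fix p assume "p \<in> spins (V - S) \<times> spins S"
    then show "(restrict (merge (V - S) S p) (V - S), restrict (merge (V - S) S p) S) = p"
      by (auto simp: spins_def PiE_iff extensional_restrict)
  next
    fix p assume "p \<in> spins (V - S) \<times> spins S"
    then obtain \<tau> s where p: "p = (\<tau>, s)" "\<tau> \<in> spins (V - S)" "s \<in> spins S" by blast
    show "merge (V - S) S p \<in> spins V"
      unfolding spins_def
    proof (rule PiE_I)
      fix v assume "v \<in> V"
      then show "merge (V - S) S p v \<in> {-1, 1}"
        using p(2,3) unfolding p(1) spins_def by (cases "v \<in> S") (simp_all add: PiE_iff)
    next
      fix v assume "v \<notin> V"
      then show "merge (V - S) S p v = undefined"
        using assms by (auto simp: p(1) merge_def)
    qed
  next
    fix \<sigma> assume "\<sigma> \<in> spins V"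
    then have "merge (V - S) S (restrict \<sigma> (V - S), restrict \<sigma> S) = \<sigma>"
      using assms by (fastforce simp: spins_def merge_def PiE_iff extensional_def fun_eq_iff)
    then show "(case (restrict \<sigma> (V - S), restrict \<sigma> S) of
        (\<tau>, s) \<Rightarrow> f (merge (V - S) S (\<tau>, s))) = f \<sigma>" by simp
  qed
  then show ?thesis by (simp add: sum.cartesian_product)
qed

text \<open>Given the configuration \<open>\<tau>\<close> off \<open>S\<close>, the weight factorises over \<open>S\<close>, and the two values of one spin
  contribute \<open>exp m + exp (-m)\<close> with \<open>m\<close> the total field at its site divided by \<open>T\<close>.\<close>

lemma partition_function_integrate_out:
  assumes "finite V" and "S \<subseteq> V" and indep: "\<forall>u\<in>S. \<forall>v\<in>S. \<not> u \<sim>\<^sub>1 v"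
  shows "partition_function T V \<xi> \<eta> =
    (\<Sum>\<tau>\<in>spins (V - S). exp (rest_exponent V S \<xi> \<eta> \<tau> / T)
       * (\<Prod>u\<in>S. 2 * cosh ((local_field V \<xi> \<tau> u + \<eta> u) / T)))"
proof -
  have finS: "finite S" using assms finite_subset by blast
  have "(\<Sum>s\<in>spins S. exp (- (1 / T) * hamiltonian V \<xi> \<eta> (merge (V - S) S (\<tau>, s)))) =
      exp (rest_exponent V S \<xi> \<eta> \<tau> / T) * (\<Prod>u\<in>S. 2 * cosh ((local_field V \<xi> \<tau> u + \<eta> u) / T))" for \<tau>
  proof -
    let ?m = "\<lambda>u. (local_field V \<xi> \<tau> u + \<eta> u) / T"
    have "exp (- (1 / T) * hamiltonian V \<xi> \<eta> (merge (V - S) S (\<tau>, s))) =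
        exp (rest_exponent V S \<xi> \<eta> \<tau> / T) * (\<Prod>u\<in>S. exp (s u * ?m u))" for s
    proof -
      let ?\<sigma> = "merge (V - S) S (\<tau>, s)"
      have "rest_exponent V S \<xi> \<eta> ?\<sigma> = rest_exponent V S \<xi> \<eta> \<tau>"
        by (rule rest_exponent_cong) (simp add: merge_def)
      moreover have "local_field V \<xi> ?\<sigma> u = local_field V \<xi> \<tau> u" if "u \<in> S" for u
        by (rule local_field_cong[of V S]) (use indep that in \<open>auto simp: merge_def\<close>)
      moreover have "?\<sigma> u = s u" if "u \<in> S" for u
        using that by (simp add: merge_def)
      ultimately have "hamiltonian V \<xi> \<eta> ?\<sigma> =
          - (rest_exponent V S \<xi> \<eta> \<tau> + (\<Sum>u\<in>S. s u * (local_field V \<xi> \<tau> u + \<eta> u)))"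
        unfolding hamiltonian_split[OF assms] by simp
      moreover have "(\<Sum>u\<in>S. s u * ?m u) = (\<Sum>u\<in>S. s u * (local_field V \<xi> \<tau> u + \<eta> u)) / T"
        by (simp add: sum_divide_distrib)
      moreover have "- (1 / T) * - (a + b) = a / T + b / T" for a b
        by (simp add: diff_divide_distrib)
      ultimately show ?thesis
        unfolding exp_sum[OF finS, symmetric] exp_add[symmetric] by (simp only:)
    qed
    then have "(\<Sum>s\<in>spins S. exp (- (1 / T) * hamiltonian V \<xi> \<eta> (merge (V - S) S (\<tau>, s)))) =
        exp (rest_exponent V S \<xi> \<eta> \<tau> / T) * (\<Sum>s\<in>spins S. \<Prod>u\<in>S. exp (s u * ?m u))"
      by (simp add: sum_distrib_left)
    also have "(\<Sum>s\<in>spins S. \<Prod>u\<in>S. exp (s u * ?m u)) = (\<Prod>u\<in>S. \<Sum>y\<in>{-1, 1::real}. exp (y * ?m u))"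
      unfolding spins_def by (rule prod_sum_PiE[symmetric]) (auto simp: finS)
    also have "\<dots> = (\<Prod>u\<in>S. 2 * cosh (?m u))"
    proof (intro prod.cong refl)
      have "(\<Sum>y\<in>{-1, 1::real}. exp (y * m)) = 2 * cosh m" for m
        by (simp add: cosh_field_def)
      then show "(\<Sum>y\<in>{-1, 1::real}. exp (y * ?m u)) = 2 * cosh (?m u)" for u .
    qed
    finally show ?thesis .
  qed
  then show ?thesis
    unfolding partition_function_def sum_spins_split[OF assms(2)] by simp
qed

section \<open>Affinity of two Gibbs measures\<close>

text \<open>A bound for the squared Hellinger affinity of two single-spin laws whose fields differ by \<open>y\<close>, valid
  as long as one of the fields is at most \<open>X\<close> in absolute value.\<close>

definition site_overlap :: "real \<Rightarrow> real \<Rightarrow> real" where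
  "site_overlap X y = 1 - (1 - 1 / cosh y) / (1 + exp (2 * X))"

lemma site_overlap_bounds: "0 < site_overlap X y" "site_overlap X y \<le> 1"
proof -
  have c: "cosh y \<ge> 1" by (rule cosh_real_ge_1)
  have "(1 - 1 / cosh y) < 1 + exp (2 * X)"
    using c by (smt (verit) divide_pos_pos exp_gt_zero)
  then show "0 < site_overlap X y"
    unfolding site_overlap_def by (simp add: add_pos_pos)
  show "site_overlap X y \<le> 1"
    unfolding site_overlap_def using c by (simp add: add_pos_pos)
qed

text \<open>By the product formulas the ratio of the left-hand side to \<open>cosh (x + y) * cosh x\<close> is
  \<open>(A + 1) / (A + C)\<close> with \<open>A = cosh (2x + y)\<close> and \<open>C = cosh y\<close>. It differs from \<open>1\<close> by
  \<open>(C - 1) / (A + C)\<close>, and \<open>A \<le> exp (2X) C\<close> removes the dependence on \<open>x\<close>.\<close>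

lemma cosh_midpoint_le:
  assumes "\<bar>x\<bar> \<le> X"
  shows "(cosh (x + y / 2))\<^sup>2 \<le> site_overlap X y * (cosh (x + y) * cosh x)"
proof -
  define A where "A = cosh (2 * x + y)"
  define C where "C = cosh y"
  define E where "E = exp (2 * X)"
  have C: "C \<ge> 1" and A0: "A \<ge> 1" unfolding A_def C_def by (rule cosh_real_ge_1)+
  have l: "2 * (cosh (x + y / 2))\<^sup>2 = A + 1"
    using cosh_double_cosh[of "x + y / 2"] by (simp add: A_def algebra_simps)
  have "cosh ((x + y) + x) = cosh (x + y) * cosh x + sinh (x + y) * sinh x"
       "cosh ((x + y) - x) = cosh (x + y) * cosh x - sinh (x + y) * sinh x"
    by (rule cosh_add cosh_diff)+
  then have r: "2 * (cosh (x + y) * cosh x) = A + C"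
    by (simp add: A_def C_def algebra_simps)
  have "exp (2 * x + y) \<le> E * exp y" "exp (- (2 * x + y)) \<le> E * exp (- y)"
    using assms by (auto simp: E_def exp_add[symmetric])
  then have AE: "A \<le> E * C"
    by (simp add: A_def C_def cosh_def algebra_simps)
  have Ep: "E > 0" by (simp add: E_def)
  have "(C - 1) * (A + C) \<le> (C - 1) * ((1 + E) * C)"
    using AE C by (intro mult_left_mono) (auto simp: algebra_simps)
  then have "(1 - 1 / C) / (1 + E) * (A + C) \<le> C - 1"
    using C Ep by (simp add: divide_simps mult_ac)
  then have "A + 1 \<le> site_overlap X y * (A + C)"
    unfolding site_overlap_def C_def[symmetric] E_def[symmetric] by (simp add: algebra_simps)
  then have "2 * (cosh (x + y / 2))\<^sup>2 \<le> site_overlap X y * (2 * (cosh (x + y) * cosh x))"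
    unfolding l r .
  then show ?thesis by simp
qed

lemma sum_sq_le_of_geometric_mean:
  fixes a b c :: "'a \<Rightarrow> real"
  assumes "0 \<le> G" and "\<And>i. i \<in> I \<Longrightarrow> 0 \<le> a i" "\<And>i. i \<in> I \<Longrightarrow> 0 \<le> b i" "\<And>i. i \<in> I \<Longrightarrow> 0 \<le> c i"
    and "\<And>i. i \<in> I \<Longrightarrow> (a i)\<^sup>2 \<le> G * (b i * c i)"
  shows "(\<Sum>i\<in>I. a i)\<^sup>2 \<le> G * ((\<Sum>i\<in>I. b i) * (\<Sum>i\<in>I. c i))"
proof -
  have "a i \<le> sqrt (G * b i) * sqrt (c i)" if "i \<in> I" for i
  proof -
    have "a i \<le> sqrt (G * (b i * c i))"
      using assms that by (intro real_le_rsqrt) auto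
    then show ?thesis by (simp add: real_sqrt_mult mult_ac)
  qed
  then have "(\<Sum>i\<in>I. a i)\<^sup>2 \<le> (\<Sum>i\<in>I. sqrt (G * b i) * sqrt (c i))\<^sup>2"
    using assms by (intro power_mono sum_mono sum_nonneg) auto
  also have "\<dots> \<le> (\<Sum>i\<in>I. (sqrt (G * b i))\<^sup>2) * (\<Sum>i\<in>I. (sqrt (c i))\<^sup>2)"
    by (rule Cauchy_Schwarz_ineq_sum)
  also have "\<dots> = (\<Sum>i\<in>I. G * b i) * (\<Sum>i\<in>I. c i)"
    using assms by (intro arg_cong2[where f = "(*)"] sum.cong) auto
  finally show ?thesis by (simp add: sum_distrib_left[symmetric] mult_ac)
qed

text \<open>Log-convexity of the partition function in the field, with a quantitative gain from each site of
  \<open>S\<close>. The exponent off \<open>S\<close> is affine in the field, so its weight at \<open>\<eta> / 2\<close> is exactly the geometric mean of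
  those at \<open>\<eta>\<close> and \<open>0\<close>; the gain comes from the hyperbolic cosines. It is uniform in the spins off \<open>S\<close> and
  therefore survives the Cauchy-Schwarz inequality for the sum over them.\<close>

lemma partition_function_midpoint_le:
  assumes "finite V" and "S \<subseteq> V" and indep: "\<forall>u\<in>S. \<forall>v\<in>S. \<not> u \<sim>\<^sub>1 v"
    and \<xi>: "\<And>v. \<bar>\<xi> v\<bar> \<le> 1" and "T > 0"
  shows "(partition_function T V \<xi> (\<lambda>u. \<eta> u / 2))\<^sup>2 \<le>
    (\<Prod>u\<in>S. site_overlap (4 / T) (\<eta> u / T))
      * (partition_function T V \<xi> \<eta> * partition_function T V \<xi> (\<lambda>_. 0))"
  unfolding partition_function_integrate_out[OF assms(1-3)]
proof (rule sum_sq_le_of_geometric_mean)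
  show "0 \<le> (\<Prod>u\<in>S. site_overlap (4 / T) (\<eta> u / T))"
    by (intro prod_nonneg) (auto intro: less_imp_le site_overlap_bounds)
next
  fix \<tau> assume \<tau>: "\<tau> \<in> spins (V - S)"
  let ?m = "\<lambda>u. local_field V \<xi> \<tau> u" and ?R = "\<lambda>\<eta>. rest_exponent V S \<xi> \<eta> \<tau> / T"
  have rest: "(exp (?R (\<lambda>u. \<eta> u / 2)))\<^sup>2 = exp (?R \<eta>) * exp (?R (\<lambda>_. 0))"
  proof -
    have "2 * rest_exponent V S \<xi> (\<lambda>u. \<eta> u / 2) \<tau> = rest_exponent V S \<xi> \<eta> \<tau> + rest_exponent V S \<xi> (\<lambda>_. 0) \<tau>"
      by (simp add: rest_exponent_def sum_divide_distrib[symmetric])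
    then show ?thesis
      by (simp add: exp_double[symmetric] exp_add[symmetric] add_divide_distrib[symmetric])
  qed
  have m: "\<bar>?m u / T\<bar> \<le> 4 / T" if "u \<in> S" for u
  proof -
    \<comment> \<open>The local field at \<open>u\<close> does not see \<open>S\<close>, where \<open>\<tau>\<close> is \<open>undefined\<close> and hence not known to be bounded.\<close>
    let ?\<tau> = "\<lambda>v. if v \<in> V - S then \<tau> v else 0"
    have "?m u = local_field V \<xi> ?\<tau> u"
      by (rule local_field_cong[of V S]) (use that indep in auto)
    also have "\<bar>\<dots>\<bar> \<le> 4"
    proof (rule abs_local_field_le)
      fix v
      have "v \<in> V - S \<Longrightarrow> \<tau> v \<in> {-1, 1}" using \<tau> by (auto simp: spins_def PiE_iff)
      then show "\<bar>?\<tau> v\<bar> \<le> 1" by auto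
    qed (rule \<xi>)
    finally show ?thesis using \<open>T > 0\<close> by (simp add: divide_right_mono)
  qed
  have "(\<Prod>u\<in>S. 2 * cosh ((?m u + \<eta> u / 2) / T))\<^sup>2 = (\<Prod>u\<in>S. (2 * cosh ((?m u + \<eta> u / 2) / T))\<^sup>2)"
    by (simp add: prod_power_distrib)
  also have "\<dots> \<le> (\<Prod>u\<in>S. site_overlap (4 / T) (\<eta> u / T)
      * ((2 * cosh ((?m u + \<eta> u) / T)) * (2 * cosh ((?m u + 0) / T))))"
  proof (intro prod_mono conjI)
    fix u assume "u \<in> S"
    show "(2 * cosh ((?m u + \<eta> u / 2) / T))\<^sup>2 \<le> site_overlap (4 / T) (\<eta> u / T)
      * ((2 * cosh ((?m u + \<eta> u) / T)) * (2 * cosh ((?m u + 0) / T)))"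
      using cosh_midpoint_le[OF m[OF \<open>u \<in> S\<close>], of "\<eta> u / T"]
      by (simp add: add_divide_distrib power_mult_distrib mult_ac)
  qed auto
  finally have "(\<Prod>u\<in>S. 2 * cosh ((?m u + \<eta> u / 2) / T))\<^sup>2 \<le> (\<Prod>u\<in>S. site_overlap (4 / T) (\<eta> u / T))
      * ((\<Prod>u\<in>S. 2 * cosh ((?m u + \<eta> u) / T)) * (\<Prod>u\<in>S. 2 * cosh ((?m u + 0) / T)))"
    unfolding prod.distrib[symmetric] .
  then have "exp (?R \<eta>) * exp (?R (\<lambda>_. 0)) * (\<Prod>u\<in>S. 2 * cosh ((?m u + \<eta> u / 2) / T))\<^sup>2 \<le>
      exp (?R \<eta>) * exp (?R (\<lambda>_. 0)) * ((\<Prod>u\<in>S. site_overlap (4 / T) (\<eta> u / T))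
      * ((\<Prod>u\<in>S. 2 * cosh ((?m u + \<eta> u) / T)) * (\<Prod>u\<in>S. 2 * cosh ((?m u + 0) / T))))"
    by (intro mult_left_mono) auto
  then show "(exp (?R (\<lambda>u. \<eta> u / 2)) * (\<Prod>u\<in>S. 2 * cosh ((?m u + \<eta> u / 2) / T)))\<^sup>2 \<le>
      (\<Prod>u\<in>S. site_overlap (4 / T) (\<eta> u / T))
      * ((exp (?R \<eta>) * (\<Prod>u\<in>S. 2 * cosh ((?m u + \<eta> u) / T)))
        * (exp (?R (\<lambda>_. 0)) * (\<Prod>u\<in>S. 2 * cosh ((?m u + 0) / T))))"
    by (simp only: power_mult_distrib rest mult_ac)
qed (auto intro!: mult_nonneg_nonneg prod_nonneg)

section \<open>Total variation bounds for a fixed field\<close>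

lemma tv_dist_finite:
  assumes "finite A" and "\<And>x. x \<notin> A \<Longrightarrow> pmf p x = 0" "\<And>x. x \<notin> A \<Longrightarrow> pmf q x = 0"
  shows "tv_dist p q = 1 / 2 * (\<Sum>x\<in>A. \<bar>pmf p x - pmf q x\<bar>)"
proof -
  have "(\<Sum>\<^sub>\<infinity>x\<in>UNIV. \<bar>pmf p x - pmf q x\<bar>) = (\<Sum>\<^sub>\<infinity>x\<in>A. \<bar>pmf p x - pmf q x\<bar>)"
    by (rule infsum_cong_neutral) (use assms in auto)
  then show ?thesis unfolding tv_dist_def using assms by simp
qed

lemma sum_pmf_support:
  assumes "finite A" and "\<And>x. x \<notin> A \<Longrightarrow> pmf p x = 0"
  shows "(\<Sum>x\<in>A. pmf p x) = 1"
proof (rule sum_pmf_eq_1)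
  show "set_pmf p \<subseteq> A" using assms(2) unfolding set_pmf_eq by blast
qed (rule assms)

text \<open>The overlap \<open>\<Sum>x. min (p x) (q x)\<close> equals one minus the total variation distance, and a minimum is
  at most the geometric mean.\<close>

lemma one_minus_tv_dist_bounds:
  assumes "finite A" and "\<And>x. x \<notin> A \<Longrightarrow> pmf p x = 0" "\<And>x. x \<notin> A \<Longrightarrow> pmf q x = 0"
  shows "0 \<le> 1 - tv_dist p q" "1 - tv_dist p q \<le> (\<Sum>x\<in>A. sqrt (pmf p x * pmf q x))"
proof -
  have "(\<Sum>x\<in>A. min (pmf p x) (pmf q x)) =
      (\<Sum>x\<in>A. (pmf p x + pmf q x) / 2 - \<bar>pmf p x - pmf q x\<bar> / 2)"
    by (intro sum.cong) (auto simp: min_def field_simps)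
  also have "\<dots> = 1 - tv_dist p q"
    using sum_pmf_support[OF assms(1,2)] sum_pmf_support[OF assms(1,3)]
    by (simp add: sum_subtractf sum.distrib sum_divide_distrib[symmetric] tv_dist_finite[OF assms])
  finally have *: "1 - tv_dist p q = (\<Sum>x\<in>A. min (pmf p x) (pmf q x))" by simp
  show "0 \<le> 1 - tv_dist p q" unfolding * by (intro sum_nonneg) auto
  show "1 - tv_dist p q \<le> (\<Sum>x\<in>A. sqrt (pmf p x * pmf q x))"
    unfolding * 
  proof (rule sum_mono)
    fix x
    have "(min (pmf p x) (pmf q x))\<^sup>2 \<le> pmf p x * pmf q x"
      unfolding power2_eq_square by (intro mult_mono) auto
    then show "min (pmf p x) (pmf q x) \<le> sqrt (pmf p x * pmf q x)" by (rule real_le_rsqrt)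
  qed
qed

lemma hamiltonian_field:
  "hamiltonian V \<xi> \<eta> \<sigma> = hamiltonian V \<xi> (\<lambda>_. 0) \<sigma> - (\<Sum>u\<in>V. \<eta> u * \<sigma> u)"
  by (simp add: hamiltonian_def)

text \<open>The geometric mean of the weights for the fields \<open>\<eta>\<close> and \<open>0\<close> is the weight for \<open>\<eta> / 2\<close>, so the affinity
  of the two measures is a ratio of partition functions.\<close>

lemma tv_dist_ising_large_field:
  assumes "finite V" and "S \<subseteq> V" and indep: "\<forall>u\<in>S. \<forall>v\<in>S. \<not> u \<sim>\<^sub>1 v"
    and \<xi>: "\<And>v. \<bar>\<xi> v\<bar> \<le> 1" and "T > 0"
  shows "(tv_dist (ising_measure T V \<xi> \<eta>) (ising_measure T V \<xi> (\<lambda>_. 0)) - 1)\<^sup>2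
    \<le> (\<Prod>u\<in>S. site_overlap (4 / T) (\<eta> u / T))"
proof -
  let ?p = "ising_measure T V \<xi> \<eta>" and ?q = "ising_measure T V \<xi> (\<lambda>_. 0)"
  let ?Z = "partition_function T V \<xi>"
  let ?w = "\<lambda>\<eta> \<sigma>. exp (- (1 / T) * hamiltonian V \<xi> \<eta> \<sigma>)"
  have Z: "?Z \<eta> > 0" for \<eta> by (rule partition_function_pos[OF assms(1)])
  have "sqrt (pmf ?p \<sigma> * pmf ?q \<sigma>) = ?w (\<lambda>u. \<eta> u / 2) \<sigma> / sqrt (?Z \<eta> * ?Z (\<lambda>_. 0))"
    if "\<sigma> \<in> spins V" for \<sigma>
  proof -
    have "?w \<eta> \<sigma> * ?w (\<lambda>_. 0) \<sigma> = (?w (\<lambda>u. \<eta> u / 2) \<sigma>)\<^sup>2"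
      unfolding exp_double[symmetric] exp_add[symmetric]
      by (subst (1 3) hamiltonian_field) (simp add: sum_divide_distrib[symmetric] algebra_simps)
    then have "pmf ?p \<sigma> * pmf ?q \<sigma> = (?w (\<lambda>u. \<eta> u / 2) \<sigma>)\<^sup>2 / (?Z \<eta> * ?Z (\<lambda>_. 0))"
      using that by (simp add: pmf_ising_measure[OF assms(1)])
    then show ?thesis by (simp add: real_sqrt_divide)
  qed
  then have "(\<Sum>\<sigma>\<in>spins V. sqrt (pmf ?p \<sigma> * pmf ?q \<sigma>)) =
      ?Z (\<lambda>u. \<eta> u / 2) / sqrt (?Z \<eta> * ?Z (\<lambda>_. 0))"
    unfolding partition_function_def[of T V \<xi> "\<lambda>u. \<eta> u / 2"] by (simp add: sum_divide_distrib)
  moreover have "0 \<le> 1 - tv_dist ?p ?q"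
      "1 - tv_dist ?p ?q \<le> (\<Sum>\<sigma>\<in>spins V. sqrt (pmf ?p \<sigma> * pmf ?q \<sigma>))"
    by (rule one_minus_tv_dist_bounds[OF finite_spins[OF assms(1)]];
        simp add: pmf_ising_measure[OF assms(1)])+
  ultimately have "(1 - tv_dist ?p ?q)\<^sup>2 \<le> (?Z (\<lambda>u. \<eta> u / 2) / sqrt (?Z \<eta> * ?Z (\<lambda>_. 0)))\<^sup>2"
    by (intro power_mono) auto
  also have "\<dots> = (?Z (\<lambda>u. \<eta> u / 2))\<^sup>2 / (?Z \<eta> * ?Z (\<lambda>_. 0))"
    using Z by (simp add: power_divide less_imp_le)
  also have "\<dots> \<le> (\<Prod>u\<in>S. site_overlap (4 / T) (\<eta> u / T))"
    using partition_function_midpoint_le[OF assms, where \<eta> = \<eta>] Z by (simp add: divide_le_eq)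
  finally show ?thesis by (simp add: power2_commute)
qed

text \<open>The constant \<open>c\<close> stands for an approximate normalisation of the tilt. With \<open>W \<sigma> = c exp (\<eta> \<cdot> \<sigma> / T)\<close>,
  replacing the exact one by \<open>c\<close> costs no more than the mean of \<open>|W - 1|\<close> under the measure without
  field, because the error in the normalisation is itself
  bounded by that mean. The advantage is that, for a \<open>c\<close> independent of the field, the
  right-hand side is a sum of terms with explicit expectation over a Gaussian field.\<close>

lemma tv_dist_ising_small_field:
  assumes "finite V" and "c > 0"
  shows "(tv_dist (ising_measure T V \<xi> \<eta>) (ising_measure T V \<xi> (\<lambda>_. 0)))\<^sup>2 \<le>
    (\<Sum>\<sigma>\<in>spins V. pmf (ising_measure T V \<xi> (\<lambda>_. 0)) \<sigma>
       * (c * exp ((\<Sum>u\<in>V. \<eta> u * \<sigma> u) / T) - 1)\<^sup>2)"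
proof -
  let ?p = "ising_measure T V \<xi> \<eta>"
  define q where "q = pmf (ising_measure T V \<xi> (\<lambda>_. 0))"
  define W where "W \<sigma> = c * exp ((\<Sum>u\<in>V. \<eta> u * \<sigma> u) / T)" for \<sigma>
  define z where "z = (\<Sum>\<sigma>\<in>spins V. q \<sigma> * W \<sigma>)"
  define D where "D = (\<Sum>\<sigma>\<in>spins V. q \<sigma> * \<bar>W \<sigma> - 1\<bar>)"
  let ?Z = "partition_function T V \<xi>"
  have Z: "?Z \<eta> > 0" for \<eta> by (rule partition_function_pos[OF assms(1)])
  have q0: "q \<sigma> \<ge> 0" for \<sigma> by (simp add: q_def)
  have q1: "(\<Sum>\<sigma>\<in>spins V. q \<sigma>) = 1"
    unfolding q_def by (rule sum_pmf_support)
      (auto simp: finite_spins assms pmf_ising_measure)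
  have qW: "q \<sigma> * W \<sigma> = c * exp (- (1 / T) * hamiltonian V \<xi> \<eta> \<sigma>) / ?Z (\<lambda>_. 0)"
    if "\<sigma> \<in> spins V" for \<sigma>
    using that by (subst hamiltonian_field)
      (simp add: q_def W_def pmf_ising_measure[OF assms(1)] exp_add[symmetric] diff_divide_distrib)
  have z: "z = c * ?Z \<eta> / ?Z (\<lambda>_. 0)"
    by (simp add: z_def qW partition_function_def[of T V \<xi> \<eta>] sum_divide_distrib sum_distrib_left)
  have z0: "z > 0" using Z assms by (simp add: z)
  have p: "pmf ?p \<sigma> = q \<sigma> * W \<sigma> / z" if "\<sigma> \<in> spins V" for \<sigma>
    unfolding z qW[OF that] using that Z assms by (simp add: pmf_ising_measure[OF assms(1)] less_imp_neq[symmetric])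
  have "1 - z = (\<Sum>\<sigma>\<in>spins V. q \<sigma> * (1 - W \<sigma>))"
    by (simp add: z_def right_diff_distrib sum_subtractf q1)
  then have zD: "\<bar>1 - z\<bar> \<le> D"
    unfolding D_def using q0 by (auto intro!: order.trans[OF sum_abs] sum_mono simp: abs_mult abs_minus_commute)
  have "2 * tv_dist ?p (ising_measure T V \<xi> (\<lambda>_. 0)) = (\<Sum>\<sigma>\<in>spins V. \<bar>pmf ?p \<sigma> - q \<sigma>\<bar>)"
    unfolding q_def by (subst tv_dist_finite[OF finite_spins[OF assms(1)]])
       (auto simp: pmf_ising_measure[OF assms(1)])
  also have "\<dots> = (\<Sum>\<sigma>\<in>spins V. \<bar>q \<sigma> * W \<sigma> / z - q \<sigma>\<bar>)"
    by (simp add: p)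
  \<comment> \<open>Compare both \<open>q W / z\<close> and \<open>q\<close> with the unnormalised \<open>q W\<close>.\<close>
  also have "\<dots> \<le> (\<Sum>\<sigma>\<in>spins V. q \<sigma> * W \<sigma> / z * \<bar>1 - z\<bar> + q \<sigma> * \<bar>W \<sigma> - 1\<bar>)"
  proof (rule sum_mono)
    fix \<sigma>
    have "q \<sigma> * W \<sigma> / z - q \<sigma> = q \<sigma> * W \<sigma> / z * (1 - z) + q \<sigma> * (W \<sigma> - 1)"
      using z0 by (simp add: field_simps)
    also have "\<bar>\<dots>\<bar> \<le> \<bar>q \<sigma> * W \<sigma> / z * (1 - z)\<bar> + \<bar>q \<sigma> * (W \<sigma> - 1)\<bar>" by (rule abs_triangle_ineq)
    also have "\<dots> = q \<sigma> * W \<sigma> / z * \<bar>1 - z\<bar> + q \<sigma> * \<bar>W \<sigma> - 1\<bar>"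
      using z0 q0[of \<sigma>] assms by (simp add: abs_mult W_def)
    finally show "\<bar>q \<sigma> * W \<sigma> / z - q \<sigma>\<bar> \<le> q \<sigma> * W \<sigma> / z * \<bar>1 - z\<bar> + q \<sigma> * \<bar>W \<sigma> - 1\<bar>" .
  qed
  also have "\<dots> = \<bar>1 - z\<bar> + D"
    using z0 by (simp add: sum.distrib D_def sum_distrib_right[symmetric] sum_divide_distrib[symmetric] z_def[symmetric])
  also have "\<dots> \<le> 2 * D" using zD by simp
  finally have "tv_dist ?p (ising_measure T V \<xi> (\<lambda>_. 0)) \<le> D" by simp
  moreover have "0 \<le> tv_dist ?p (ising_measure T V \<xi> (\<lambda>_. 0))"
    by (auto simp: tv_dist_def intro!: infsum_nonneg)
  ultimately have "(tv_dist ?p (ising_measure T V \<xi> (\<lambda>_. 0)))\<^sup>2 \<le> D\<^sup>2"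
    by (rule power_mono)
  also have "\<dots> \<le> 1 * ((\<Sum>\<sigma>\<in>spins V. q \<sigma>) * (\<Sum>\<sigma>\<in>spins V. q \<sigma> * (W \<sigma> - 1)\<^sup>2))"
    unfolding D_def using q0
    by (intro sum_sq_le_of_geometric_mean) (auto simp: power_mult_distrib power2_eq_square[of "q _"])
  finally show ?thesis unfolding q1 by (simp add: q_def W_def)
qed

section \<open>Averaging over the Gaussian field\<close>

lemma tendsto_in_prob_if_second_moment:
  assumes M: "prob_space M" and X: "\<And>N. X N \<in> borel_measurable M"
    and bound: "\<And>N w. (X N w - c)\<^sup>2 \<le> Q N w"
    and Q: "\<And>N. integrable M (Q N)"
    and b: "\<And>N. integral\<^sup>L M (Q N) \<le> b N" "b \<longlonglongrightarrow> 0"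
  shows "tendsto_in_prob M X c"
  unfolding tendsto_in_prob_def
proof (intro conjI allI impI X)
  interpret prob_space M by (rule M)
  fix \<delta> :: real assume \<delta>: "\<delta> > 0"
  have [measurable]: "X N \<in> borel_measurable M" "Q N \<in> borel_measurable M" for N
    using X Q by auto
  have upper: "measure M {w \<in> space M. \<bar>X N w - c\<bar> > \<delta>} \<le> b N / \<delta>\<^sup>2" for N
  proof -
    have "\<delta>\<^sup>2 \<le> Q N w" if "\<bar>X N w - c\<bar> > \<delta>" for w
    proof -
      have "\<delta>\<^sup>2 \<le> \<bar>X N w - c\<bar>\<^sup>2" using that \<delta> by (intro power_mono) auto
      then show ?thesis using bound[of N w] by simp
    qed
    then have "measure M {w \<in> space M. \<bar>X N w - c\<bar> > \<delta>} \<le> measure M {w \<in> space M. Q N w \<ge> \<delta>\<^sup>2}"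
      by (intro finite_measure_mono) auto
    also have "\<dots> \<le> integral\<^sup>L M (Q N) / \<delta>\<^sup>2"
    proof (rule integral_Markov_inequality_measure[where A = "{}"])
      show "AE w in M. 0 \<le> Q N w"
        using bound by (intro AE_I2) (meson order_trans zero_le_power2)
    qed (use Q \<delta> in auto)
    also have "\<dots> \<le> b N / \<delta>\<^sup>2" using b(1)[of N] by (intro divide_right_mono) auto
    finally show ?thesis .
  qed
  have lim: "(\<lambda>N. b N / \<delta>\<^sup>2) \<longlonglongrightarrow> 0"
    using tendsto_divide[OF b(2) tendsto_const[of "\<delta>\<^sup>2"]] \<delta> by simp
  show "(\<lambda>N. measure M {w \<in> space M. \<bar>X N w - c\<bar> > \<delta>}) \<longlonglongrightarrow> 0"
    by (rule tendsto_sandwich[OF _ _ tendsto_const lim]) (simp_all add: upper)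
qed

lemma borel_measurable_tv_dist_ising:
  assumes "finite V" and [measurable]: "\<And>x. \<eta> x \<in> borel_measurable M"
  shows "(\<lambda>w. tv_dist (ising_measure T V \<xi> (\<lambda>x. \<eta> x w)) (ising_measure T V \<xi> (\<lambda>_. 0)))
    \<in> borel_measurable M"
proof -
  have eq: "tv_dist (ising_measure T V \<xi> (\<lambda>x. \<eta> x w)) (ising_measure T V \<xi> (\<lambda>_. 0)) =
      1 / 2 * (\<Sum>\<sigma>\<in>spins V. \<bar>pmf (ising_measure T V \<xi> (\<lambda>x. \<eta> x w)) \<sigma>
        - pmf (ising_measure T V \<xi> (\<lambda>_. 0)) \<sigma>\<bar>)" for w
    by (rule tv_dist_finite) (auto simp: finite_spins assms pmf_ising_measure)
  show ?thesis
    unfolding eq pmf_ising_measure[OF assms(1)] partition_function_def hamiltonian_def by measurable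
qed

lemma iid_std_normal_marginal:
  assumes "iid_std_normal M h"
  shows "distributed M lborel (h u) std_normal_density" and "h u \<in> borel_measurable M"
proof -
  show d: "distributed M lborel (h u) std_normal_density"
    using assms unfolding iid_std_normal_def by blast
  show "h u \<in> borel_measurable M"
    using distributed_measurable[OF d] by simp
qed

text \<open>Completing the square: tilting the standard normal density by \<open>exp (c x)\<close> gives a multiple of the
  normal density with mean \<open>c\<close>.\<close>

lemma std_normal_exp:
  assumes "distributed M lborel X std_normal_density"
  shows "integrable M (\<lambda>w. exp (c * X w))" "(\<integral>w. exp (c * X w) \<partial>M) = exp (c\<^sup>2 / 2)"
proof -
  have *: "std_normal_density x * exp (c * x) = exp (c\<^sup>2 / 2) * normal_density c 1 x" for x
    by (simp add: normal_density_def exp_add[symmetric] power2_eq_square field_simps)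
  have "integrable lborel (\<lambda>x. std_normal_density x * exp (c * x))"
    unfolding * by simp
  then show "integrable M (\<lambda>w. exp (c * X w))"
    using distributed_integrable[OF assms, of "\<lambda>x. exp (c * x)"] by simp
  have "(\<integral>w. exp (c * X w) \<partial>M) = (\<integral>x. std_normal_density x * exp (c * x) \<partial>lborel)"
    using distributed_integral[OF assms, of "\<lambda>x. exp (c * x)"] by simp
  also have "\<dots> = exp (c\<^sup>2 / 2)"
    unfolding * by simp
  finally show "(\<integral>w. exp (c * X w) \<partial>M) = exp (c\<^sup>2 / 2)" .
qed

lemma iid_prod:
  fixes g :: "'i \<Rightarrow> real \<Rightarrow> real"
  assumes "prob_space M" "iid_std_normal M h" and "finite I"
    and "\<And>i. i \<in> I \<Longrightarrow> g i \<in> borel_measurable borel"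
    and "\<And>i. i \<in> I \<Longrightarrow> integrable M (\<lambda>w. g i (h i w))"
  shows "integrable M (\<lambda>w. \<Prod>i\<in>I. g i (h i w))"
    and "(\<integral>w. (\<Prod>i\<in>I. g i (h i w)) \<partial>M) = (\<Prod>i\<in>I. \<integral>w. g i (h i w) \<partial>M)"
proof -
  interpret prob_space M by (rule assms(1))
  have "indep_vars (\<lambda>_. borel) h I"
    using assms(2) indep_vars_subset[of _ h UNIV I] by (auto simp: iid_std_normal_def)
  then have ind: "indep_vars (\<lambda>_. borel) (\<lambda>i w. g i (h i w)) I"
    by (rule indep_vars_compose2) (rule assms(4))
  show "integrable M (\<lambda>w. \<Prod>i\<in>I. g i (h i w))"
    by (rule indep_vars_integrable[OF assms(3) ind assms(5)])
  show "(\<integral>w. (\<Prod>i\<in>I. g i (h i w)) \<partial>M) = (\<Prod>i\<in>I. \<integral>w. g i (h i w) \<partial>M)"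
    by (rule indep_vars_lebesgue_integral[OF assms(3) ind assms(5)])
qed

lemma iid_exp_sum:
  assumes "prob_space M" "iid_std_normal M h" and "finite I"
  shows "integrable M (\<lambda>w. exp (\<Sum>i\<in>I. c i * h i w))"
    and "(\<integral>w. exp (\<Sum>i\<in>I. c i * h i w) \<partial>M) = exp ((\<Sum>i\<in>I. (c i)\<^sup>2) / 2)"
proof -
  note d = iid_std_normal_marginal(1)[OF assms(2)]
  note * = iid_prod[OF assms, where g = "\<lambda>i x. exp (c i * x)", simplified,
      OF std_normal_exp(1)[OF d]]
  show "integrable M (\<lambda>w. exp (\<Sum>i\<in>I. c i * h i w))"
    using *(1) by (simp add: exp_sum assms(3))
  show "(\<integral>w. exp (\<Sum>i\<in>I. c i * h i w) \<partial>M) = exp ((\<Sum>i\<in>I. (c i)\<^sup>2) / 2)"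
    using *(2) by (simp add: exp_sum assms(3) std_normal_exp(2)[OF d] sum_divide_distrib)
qed

text \<open>For signs \<open>\<sigma>\<close> the combination \<open>\<Sum>i. \<sigma> i * h i\<close> has the same law as for \<open>\<sigma> = 1\<close>, so the variance of the
  normalised tilt does not depend on \<open>\<sigma>\<close>.\<close>

lemma normalised_tilt_variance:
  fixes t :: real and \<sigma> :: "'i \<Rightarrow> real"
  assumes "prob_space M" "iid_std_normal M h" and "finite I" and \<sigma>: "\<And>i. i \<in> I \<Longrightarrow> (\<sigma> i)\<^sup>2 = 1"
  defines "W \<equiv> \<lambda>w. exp (- (t\<^sup>2 * real (card I) / 2)) * exp (\<Sum>i\<in>I. t * \<sigma> i * h i w)"
  shows "integrable M (\<lambda>w. (W w - 1)\<^sup>2)"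
    and "(\<integral>w. (W w - 1)\<^sup>2 \<partial>M) = exp (t\<^sup>2 * real (card I)) - 1"
proof -
  interpret prob_space M by (rule assms(1))
  let ?n = "t\<^sup>2 * real (card I)"
  let ?E = "\<lambda>a w. exp (\<Sum>i\<in>I. a * t * \<sigma> i * h i w)"
  have int: "integrable M (?E a)" for a
    by (rule iid_exp_sum(1)[OF assms(1-3)])
  have E: "(\<integral>w. ?E a w \<partial>M) = exp (a\<^sup>2 * ?n / 2)" for a
  proof -
    have "(\<Sum>i\<in>I. (a * t * \<sigma> i)\<^sup>2) = (\<Sum>i\<in>I. (a * t)\<^sup>2)"
      using \<sigma> by (intro sum.cong) (auto simp: power_mult_distrib)
    then show ?thesis
      unfolding iid_exp_sum(2)[OF assms(1-3)] by (simp add: power_mult_distrib mult_ac)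
  qed
  have sq: "(W w - 1)\<^sup>2 = exp (- ?n) * ?E 2 w - 2 * exp (- (?n / 2)) * ?E 1 w + 1" for w
  proof -
    have "(W w)\<^sup>2 = exp (- ?n) * ?E 2 w"
      unfolding W_def by (simp add: power_mult_distrib exp_double[symmetric] sum_distrib_left mult_ac)
    then show ?thesis by (simp add: power2_diff W_def)
  qed
  show "integrable M (\<lambda>w. (W w - 1)\<^sup>2)"
    unfolding sq by (intro Bochner_Integration.integrable_add Bochner_Integration.integrable_diff
        integrable_mult_right int) simp
  have "(\<integral>w. (W w - 1)\<^sup>2 \<partial>M) =
      exp (- ?n) * (\<integral>w. ?E 2 w \<partial>M) - 2 * exp (- (?n / 2)) * (\<integral>w. ?E 1 w \<partial>M) + 1"
    unfolding sq
    by (subst Bochner_Integration.integral_add Bochner_Integration.integral_diff;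
        (intro Bochner_Integration.integrable_diff integrable_mult_right int)?;
        simp add: prob_space int[of 1, simplified])+
  also have "\<dots> = exp ?n - 1"
  proof -
    have "exp (- n) * exp (2\<^sup>2 * n / 2) - 2 * exp (- (n / 2)) * exp (1\<^sup>2 * n / 2) + 1 = exp n - 1"
      for n :: real
      by (simp add: mult.assoc exp_add[symmetric])
    then show ?thesis unfolding E .
  qed
  finally show "(\<integral>w. (W w - 1)\<^sup>2 \<partial>M) = exp ?n - 1" .
qed

text \<open>The mean of \<open>x\<^sup>2 / (1 + x\<^sup>2)\<close> for a standard normal \<open>x\<close>. This bounded substitute for the square is
  chosen because \<open>t\<^sup>2 x\<^sup>2 / (4 + t\<^sup>2 x\<^sup>2)\<close> is at least \<open>t\<^sup>2 / (4 + t\<^sup>2)\<close> times \<open>x\<^sup>2 / (1 + x\<^sup>2)\<close>, which separates the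
  strength of the field from its randomness for weak and strong fields alike.\<close>

definition soft_square_mean :: real where
  "soft_square_mean = (\<integral>x. std_normal_density x * (x\<^sup>2 / (1 + x\<^sup>2)) \<partial>lborel)"

lemma soft_square_integrable:
  "integrable lborel (\<lambda>x. std_normal_density x * (x\<^sup>2 / (1 + x\<^sup>2)))"
proof (rule Bochner_Integration.integrable_bound)
  show "integrable lborel std_normal_density" by simp
  have "std_normal_density x * (x\<^sup>2 / (1 + x\<^sup>2)) \<le> std_normal_density x * 1" for x
    by (intro mult_left_mono) (auto simp: divide_simps add_pos_nonneg)
  then show "AE x in lborel. norm (std_normal_density x * (x\<^sup>2 / (1 + x\<^sup>2))) \<le> norm (std_normal_density x)"
    by (intro AE_I2) (simp add: abs_mult)
qed measurable

text \<open>A nonnegative function with integral zero vanishes almost everywhere, whereas this one vanishes at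
  a single point.\<close>

lemma soft_square_mean_pos: "soft_square_mean > 0"
proof (rule ccontr)
  have nonneg: "AE x in lborel. 0 \<le> std_normal_density x * (x\<^sup>2 / (1 + x\<^sup>2))" by simp
  assume "\<not> soft_square_mean > 0"
  then have "soft_square_mean = 0"
    using integral_nonneg_AE[OF nonneg] unfolding soft_square_mean_def by linarith
  then have "AE x in lborel. std_normal_density x * (x\<^sup>2 / (1 + x\<^sup>2)) = 0"
    unfolding soft_square_mean_def
    using integral_nonneg_eq_0_iff_AE[OF soft_square_integrable nonneg] by simp
  then have "AE x in lborel. x = (0::real)"
  proof eventually_elim
    case (elim x)
    moreover have "std_normal_density x > 0" by (simp add: normal_density_pos)
    ultimately show ?case by (simp add: add_nonneg_eq_0_iff)
  qed
  with AE_lborel_singleton[of "0::real"] have "AE x in (lborel :: real measure). False"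
    by (rule eventually_elim2) simp
  then show False
    by (simp add: eventually_False ae_filter_eq_bot_iff)
qed

text \<open>The constant \<open>1 / 4\<close> is half the optimal one; it comes from bounding \<open>exp y\<close> to second order but
  \<open>exp (-y)\<close> only to first order.\<close>

lemma cosh_quadratic_lower: "1 + y\<^sup>2 / 4 \<le> cosh (y :: real)"
proof -
  have "1 + y\<^sup>2 / 4 \<le> cosh y" if "y \<ge> 0" for y :: real
    using exp_lower_Taylor_quadratic[OF that] exp_ge_add_one_self[of "- y"]
    by (simp add: cosh_def field_simps)
  from this[of y] this[of "- y"] show ?thesis
    by (cases "y \<ge> 0") auto
qed

lemma site_overlap_le:
  "site_overlap X (t * x) \<le>
    1 - 1 / (1 + exp (2 * X)) * (t\<^sup>2 / (4 + t\<^sup>2)) * (x\<^sup>2 / (1 + x\<^sup>2))"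
proof -
  let ?y = "t * x"
  have "t\<^sup>2 / (4 + t\<^sup>2) * (x\<^sup>2 / (1 + x\<^sup>2)) = ?y\<^sup>2 / ((4 + t\<^sup>2) * (1 + x\<^sup>2))"
    by (simp add: power_mult_distrib)
  also have "\<dots> \<le> ?y\<^sup>2 / (4 + ?y\<^sup>2)"
    by (intro divide_left_mono mult_pos_pos)
       (auto simp: algebra_simps power_mult_distrib add_pos_nonneg)
  also have "\<dots> = 1 - 1 / (1 + ?y\<^sup>2 / 4)"
    by (simp add: divide_simps add_pos_nonneg add_nonneg_eq_0_iff)
  also have "\<dots> \<le> 1 - 1 / cosh ?y"
    using cosh_real_ge_1[of ?y] cosh_quadratic_lower[of ?y]
    by (intro diff_left_mono divide_left_mono mult_pos_pos) (auto simp: add_pos_nonneg)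
  finally have "t\<^sup>2 / (4 + t\<^sup>2) * (x\<^sup>2 / (1 + x\<^sup>2)) / (1 + exp (2 * X)) \<le>
      (1 - 1 / cosh ?y) / (1 + exp (2 * X))"
    by (intro divide_right_mono) (auto intro: add_nonneg_nonneg)
  then show ?thesis by (simp add: site_overlap_def mult_ac)
qed

lemma expectation_site_overlap_prod_le:
  fixes X t :: real
  assumes "prob_space M" "iid_std_normal M h" and "finite S"
  defines "\<kappa> \<equiv> soft_square_mean / (1 + exp (2 * X))"
  shows "integrable M (\<lambda>w. \<Prod>u\<in>S. site_overlap X (t * h u w))"
    and "(\<integral>w. (\<Prod>u\<in>S. site_overlap X (t * h u w)) \<partial>M) \<le>
      exp (- (\<kappa> * (t\<^sup>2 / (4 + t\<^sup>2)) * real (card S)))"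
proof -
  interpret prob_space M by (rule assms(1))
  note d = iid_std_normal_marginal(1)[OF assms(2)]
  note [measurable] = iid_std_normal_marginal(2)[OF assms(2)]
  let ?q = "\<lambda>x::real. x\<^sup>2 / (1 + x\<^sup>2)"
  let ?r = "t\<^sup>2 / (4 + t\<^sup>2)"
  have meas: "(\<lambda>x. site_overlap X (t * x)) \<in> borel_measurable borel"
    unfolding site_overlap_def cosh_def by measurable
  have int: "integrable M (\<lambda>w. site_overlap X (t * h u w))" for u
  proof (rule integrable_const_bound[where B = 1])
    show "AE w in M. norm (site_overlap X (t * h u w)) \<le> 1"
      using site_overlap_bounds by (auto simp: less_imp_le)
    show "(\<lambda>w. site_overlap X (t * h u w)) \<in> borel_measurable M"
      by (rule measurable_compose[OF _ meas]) measurable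
  qed
  show "integrable M (\<lambda>w. \<Prod>u\<in>S. site_overlap X (t * h u w))"
    by (rule iid_prod(1)[OF assms(1-3) meas int])
  have single: "(\<integral>w. site_overlap X (t * h u w) \<partial>M) \<le> exp (- (\<kappa> * ?r))" for u
  proof -
    have qint: "integrable M (\<lambda>w. ?q (h u w))"
      using distributed_integrable[OF d, of ?q] soft_square_integrable by simp
    have qE: "(\<integral>w. ?q (h u w) \<partial>M) = soft_square_mean"
      using distributed_integral[OF d, of ?q] by (simp add: soft_square_mean_def)
    have "(\<integral>w. site_overlap X (t * h u w) \<partial>M) \<le>
        (\<integral>w. 1 - 1 / (1 + exp (2 * X)) * ?r * ?q (h u w) \<partial>M)"
      by (intro integral_mono int site_overlap_le
          Bochner_Integration.integrable_diff integrable_mult_right qint) simp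
    also have "\<dots> = 1 - 1 / (1 + exp (2 * X)) * ?r * soft_square_mean"
      using qint by (subst Bochner_Integration.integral_diff) (simp_all add: prob_space qE del: times_divide_eq_left times_divide_eq_right)
    also have "\<dots> = 1 + - (\<kappa> * ?r)"
      by (simp add: \<kappa>_def)
    also have "\<dots> \<le> exp (- (\<kappa> * ?r))" by (rule exp_ge_add_one_self)
    finally show ?thesis .
  qed
  have "(\<integral>w. (\<Prod>u\<in>S. site_overlap X (t * h u w)) \<partial>M) = (\<Prod>u\<in>S. \<integral>w. site_overlap X (t * h u w) \<partial>M)"
    by (rule iid_prod(2)[OF assms(1-3) meas int])
  also have "\<dots> \<le> (\<Prod>u\<in>S. exp (- (\<kappa> * ?r)))"
    by (intro prod_mono conjI single integral_nonneg_AE AE_I2 less_imp_le site_overlap_bounds)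
  also have "\<dots> = exp (- (\<kappa> * ?r * real (card S)))"
    by (simp add: exp_of_nat_mult[symmetric] mult_ac)
  finally show "(\<integral>w. (\<Prod>u\<in>S. site_overlap X (t * h u w)) \<partial>M) \<le>
      exp (- (\<kappa> * ?r * real (card S)))" .
qed

section \<open>The two regimes on the box\<close>

lemma finite_lattice_box: "finite (lattice_box N)"
  by (simp add: lattice_box_def)

lemma card_lattice_box: "card (lattice_box N) = (2 * N + 1)\<^sup>2"
  by (simp add: lattice_box_def card_cartesian_product power2_eq_square nat_add_distrib nat_mult_distrib)

definition even_sites :: "nat \<Rightarrow> site set" where
  "even_sites N = (\<lambda>(i, j). (2 * i, 2 * j)) `
     ({- int (N div 2)..int (N div 2)} \<times> {- int (N div 2)..int (N div 2)})"

lemma even_sites_subset: "even_sites N \<subseteq> lattice_box N"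
  by (auto simp: even_sites_def lattice_box_def)

lemma even_sites_not_adjacent: "\<forall>u\<in>even_sites N. \<forall>v\<in>even_sites N. \<not> u \<sim>\<^sub>1 v"
proof (intro ballI notI)
  fix u v assume "u \<in> even_sites N" "v \<in> even_sites N" "u \<sim>\<^sub>1 v"
  then obtain a b c d :: int where "\<bar>2 * a - 2 * c\<bar> + \<bar>2 * b - 2 * d\<bar> = 1"
    by (auto simp: even_sites_def adj_def)
  then show False by presburger
qed

lemma card_even_sites: "N\<^sup>2 \<le> card (even_sites N)"
proof -
  have "card (even_sites N) = (2 * (N div 2) + 1)\<^sup>2"
    unfolding even_sites_def
    by (subst card_image) (auto simp: inj_on_def card_cartesian_product power2_eq_square nat_add_distrib nat_mult_distrib)
  moreover have "N \<le> 2 * (N div 2) + 1" by simp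
  ultimately show ?thesis by (metis power_mono zero_le)
qed

text \<open>The bound \<open>exp (t\<^sup>2 n) - 1\<close> has exponent \<open>(2 t N + t)\<^sup>2\<close>, which tends to \<open>0\<close> together with \<open>t N\<close>.\<close>

lemma small_field_limit:
  assumes "prob_space M" "iid_std_normal M h" "T > 0"
    and lim: "(\<lambda>N. \<epsilon> N / inverse (real N)) \<longlonglongrightarrow> 0"
  shows "tendsto_in_prob M
    (\<lambda>N w. tv_dist (ising_measure T (lattice_box N) \<xi> (\<lambda>x. \<epsilon> N * h x w))
                   (ising_measure T (lattice_box N) \<xi> (\<lambda>_. 0))) 0"
proof -
  note [measurable] = iid_std_normal_marginal(2)[OF assms(2)]
  define t where "t N = \<epsilon> N / T" for N
  define n where "n N = real (card (lattice_box N))" for N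
  define p where "p N = pmf (ising_measure T (lattice_box N) \<xi> (\<lambda>_. 0))" for N
  define W where "W N \<sigma> w = exp (- ((t N)\<^sup>2 * n N / 2))
      * exp (\<Sum>u\<in>lattice_box N. t N * \<sigma> u * h u w)" for N and \<sigma> :: "site \<Rightarrow> real" and w
  have \<sigma>: "(\<sigma> u)\<^sup>2 = 1" if "\<sigma> \<in> spins (lattice_box N)" "u \<in> lattice_box N" for \<sigma> u N
    using that by (auto simp: spins_def PiE_iff power2_eq_1_iff)
  have W: "integrable M (\<lambda>w. (W N \<sigma> w - 1)\<^sup>2)"
      "(\<integral>w. (W N \<sigma> w - 1)\<^sup>2 \<partial>M) = exp ((t N)\<^sup>2 * n N) - 1"
    if "\<sigma> \<in> spins (lattice_box N)" for N \<sigma>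
  proof -
    note nv = normalised_tilt_variance[OF assms(1,2) finite_lattice_box, of N \<sigma> "t N"]
    show "integrable M (\<lambda>w. (W N \<sigma> w - 1)\<^sup>2)"
      unfolding W_def n_def by (rule nv(1)) (rule \<sigma>[OF that])
    show "(\<integral>w. (W N \<sigma> w - 1)\<^sup>2 \<partial>M) = exp ((t N)\<^sup>2 * n N) - 1"
      unfolding W_def n_def by (rule nv(2)) (rule \<sigma>[OF that])
  qed
  have p1: "(\<Sum>\<sigma>\<in>spins (lattice_box N). p N \<sigma>) = 1" for N
    unfolding p_def by (rule sum_pmf_support)
      (auto simp: finite_spins finite_lattice_box pmf_ising_measure)
  show ?thesis
  proof (rule tendsto_in_prob_if_second_moment[OF assms(1)])
    show "(\<lambda>w. tv_dist (ising_measure T (lattice_box N) \<xi> (\<lambda>x. \<epsilon> N * h x w))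
        (ising_measure T (lattice_box N) \<xi> (\<lambda>_. 0))) \<in> borel_measurable M" for N
      by (rule borel_measurable_tv_dist_ising[OF finite_lattice_box]) measurable
    show "(tv_dist (ising_measure T (lattice_box N) \<xi> (\<lambda>x. \<epsilon> N * h x w))
        (ising_measure T (lattice_box N) \<xi> (\<lambda>_. 0)) - 0)\<^sup>2
      \<le> (\<Sum>\<sigma>\<in>spins (lattice_box N). p N \<sigma> * (W N \<sigma> w - 1)\<^sup>2)" for N w
    proof -
      have "(\<Sum>u\<in>lattice_box N. \<epsilon> N * h u w * \<sigma> u) / T
          = (\<Sum>u\<in>lattice_box N. t N * \<sigma> u * h u w)" for \<sigma>
        by (simp add: sum_divide_distrib t_def mult_ac)
      then show ?thesis
        using tv_dist_ising_small_field[OF finite_lattice_box, of "exp (- ((t N)\<^sup>2 * n N / 2))" T N \<xi>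
            "\<lambda>u. \<epsilon> N * h u w"]
        by (simp add: W_def p_def)
    qed
    show "integrable M (\<lambda>w. \<Sum>\<sigma>\<in>spins (lattice_box N). p N \<sigma> * (W N \<sigma> w - 1)\<^sup>2)" for N
      by (intro Bochner_Integration.integrable_sum integrable_mult_right W)
    show "(\<integral>w. (\<Sum>\<sigma>\<in>spins (lattice_box N). p N \<sigma> * (W N \<sigma> w - 1)\<^sup>2) \<partial>M)
        \<le> exp ((t N)\<^sup>2 * n N) - 1" for N
      by (subst Bochner_Integration.integral_sum)
         (simp_all add: W sum_distrib_right[symmetric] p1)
    have "(\<lambda>N. 1 / T * (\<epsilon> N / inverse (real N))) \<longlonglongrightarrow> 1 / T * 0"
      by (intro tendsto_mult tendsto_const lim)
    moreover have "1 / T * (\<epsilon> N / inverse (real N)) = t N * real N" for N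
      by (simp add: t_def divide_inverse)
    ultimately have tN: "(\<lambda>N. t N * real N) \<longlonglongrightarrow> 0"
      by (simp only: mult_zero_right)
    have "t \<longlonglongrightarrow> 0"
    proof (rule Lim_transform_eventually)
      show "(\<lambda>N. t N * real N * inverse (real N)) \<longlonglongrightarrow> 0"
        using tendsto_mult[OF tN lim_inverse_n] by simp
      show "\<forall>\<^sub>F N in sequentially. t N * real N * inverse (real N) = t N"
        using eventually_gt_at_top[of 0] by eventually_elim simp
    qed
    then have "(\<lambda>N. exp ((2 * (t N * real N) + t N)\<^sup>2) - 1) \<longlonglongrightarrow> exp ((2 * 0 + 0)\<^sup>2) - 1"
      by (intro tendsto_intros tN)
    moreover have "(2 * (t N * real N) + t N)\<^sup>2 = (t N)\<^sup>2 * n N" for N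
      by (simp add: n_def card_lattice_box power2_eq_square algebra_simps)
    ultimately show "(\<lambda>N. exp ((t N)\<^sup>2 * n N) - 1) \<longlonglongrightarrow> 0" by simp
  qed
qed

text \<open>Since \<open>t\<close> need not be bounded or tend to \<open>0\<close>, the decay rate is controlled through its reciprocal:
  \<open>t\<^sup>2 N\<^sup>2 / (4 + t\<^sup>2) = 1 / (4 / (t N)\<^sup>2 + 1 / N\<^sup>2)\<close>.\<close>

lemma large_field_limit:
  assumes "prob_space M" "iid_std_normal M h" "T > 0" and \<xi>: "\<And>v. \<bar>\<xi> v\<bar> \<le> 1"
    and lim: "filterlim (\<lambda>N. \<epsilon> N / inverse (real N)) at_top sequentially"
  shows "tendsto_in_prob M
    (\<lambda>N w. tv_dist (ising_measure T (lattice_box N) \<xi> (\<lambda>x. \<epsilon> N * h x w))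
                   (ising_measure T (lattice_box N) \<xi> (\<lambda>_. 0))) 1"
proof -
  note [measurable] = iid_std_normal_marginal(2)[OF assms(2)]
  have fin: "finite (even_sites N)" for N
    by (rule finite_subset[OF even_sites_subset finite_lattice_box])
  define t where "t N = \<epsilon> N / T" for N
  define \<kappa> where "\<kappa> = soft_square_mean / (1 + exp (2 * (4 / T)))"
  have \<kappa>: "\<kappa> > 0" unfolding \<kappa>_def by (intro divide_pos_pos soft_square_mean_pos add_pos_pos) auto
  define r where "r N = (t N)\<^sup>2 / (4 + (t N)\<^sup>2)" for N
  have r: "r N \<ge> 0" for N by (simp add: r_def)
  show ?thesis
  proof (rule tendsto_in_prob_if_second_moment[OF assms(1)])
    show "(\<lambda>w. tv_dist (ising_measure T (lattice_box N) \<xi> (\<lambda>x. \<epsilon> N * h x w))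
        (ising_measure T (lattice_box N) \<xi> (\<lambda>_. 0))) \<in> borel_measurable M" for N
      by (rule borel_measurable_tv_dist_ising[OF finite_lattice_box]) measurable
    show "(tv_dist (ising_measure T (lattice_box N) \<xi> (\<lambda>x. \<epsilon> N * h x w))
        (ising_measure T (lattice_box N) \<xi> (\<lambda>_. 0)) - 1)\<^sup>2
      \<le> (\<Prod>u\<in>even_sites N. site_overlap (4 / T) (t N * h u w))" for N w
      using tv_dist_ising_large_field[OF finite_lattice_box even_sites_subset
          even_sites_not_adjacent \<xi> \<open>T > 0\<close>, where \<eta> = "\<lambda>u. \<epsilon> N * h u w"]
      by (simp add: t_def)
    show "integrable M (\<lambda>w. \<Prod>u\<in>even_sites N. site_overlap (4 / T) (t N * h u w))" for N
      by (rule expectation_site_overlap_prod_le(1)[OF assms(1,2) fin])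
    show "(\<integral>w. (\<Prod>u\<in>even_sites N. site_overlap (4 / T) (t N * h u w)) \<partial>M)
        \<le> exp (- (\<kappa> * (r N * (real N)\<^sup>2)))" for N
    proof -
      have "(real N)\<^sup>2 \<le> real (card (even_sites N))"
        using card_even_sites[of N] by (metis of_nat_le_iff of_nat_power)
      then have "\<kappa> * r N * (real N)\<^sup>2 \<le> \<kappa> * r N * real (card (even_sites N))"
        using \<kappa> r by (intro mult_left_mono) auto
      then have "exp (- (\<kappa> * r N * real (card (even_sites N)))) \<le> exp (- (\<kappa> * (r N * (real N)\<^sup>2)))"
        by simp
      with expectation_site_overlap_prod_le(2)[OF assms(1,2) fin, where X = "4 / T" and t = "t N"]
      show ?thesis
        unfolding \<kappa>_def[symmetric] r_def[symmetric] by (rule order_trans)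
    qed
    have "filterlim (\<lambda>N. 1 / T * (\<epsilon> N / inverse (real N))) at_top sequentially"
      using \<open>T > 0\<close> by (intro filterlim_tendsto_pos_mult_at_top[OF tendsto_const _ lim]) auto
    moreover have "1 / T * (\<epsilon> N / inverse (real N)) = t N * real N" for N
      by (simp add: t_def divide_inverse)
    ultimately have tN: "filterlim (\<lambda>N. t N * real N) at_top sequentially"
      by (simp only:)
    have i0: "(\<lambda>N. 4 * (inverse (t N * real N))\<^sup>2 + (inverse (real N))\<^sup>2) \<longlonglongrightarrow> 4 * 0\<^sup>2 + 0\<^sup>2"
      by (intro tendsto_intros lim_inverse_n tendsto_inverse_0_at_top tN)
    have "filterlim (\<lambda>N. inverse (4 * (inverse (t N * real N))\<^sup>2 + (inverse (real N))\<^sup>2))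
        at_top sequentially"
    proof (rule filterlim_inverse_at_top)
      show "(\<lambda>N. 4 * (inverse (t N * real N))\<^sup>2 + (inverse (real N))\<^sup>2) \<longlonglongrightarrow> 0"
        using i0 by simp
      show "\<forall>\<^sub>F N in sequentially. 0 < 4 * (inverse (t N * real N))\<^sup>2 + (inverse (real N))\<^sup>2"
        using eventually_gt_at_top[of 0] by eventually_elim (simp add: add_nonneg_pos)
    qed
    moreover have "\<forall>\<^sub>F N in sequentially.
        inverse (4 * (inverse (t N * real N))\<^sup>2 + (inverse (real N))\<^sup>2) = r N * (real N)\<^sup>2"
      using filterlim_at_top_dense[THEN iffD1, OF tN, rule_format, of 0]
    proof eventually_elim
      case (elim N)
      then have "t N \<noteq> 0" "real N \<noteq> 0" by (metis less_irrefl mult_zero_left mult_zero_right)+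
      then show ?case
        by (simp add: r_def field_simps power_mult_distrib power_inverse add_nonneg_eq_0_iff)
    qed
    ultimately have "filterlim (\<lambda>N. r N * (real N)\<^sup>2) at_top sequentially"
      by (rule filterlim_mono_eventually[OF _ order_refl order_refl])
    then have "filterlim (\<lambda>N. \<kappa> * (r N * (real N)\<^sup>2)) at_top sequentially"
      using \<kappa> by (intro filterlim_tendsto_pos_mult_at_top[OF tendsto_const]) auto
    then have "filterlim (\<lambda>N. - (\<kappa> * (r N * (real N)\<^sup>2))) at_bot sequentially"
      by (simp add: filterlim_uminus_at_top)
    then show "(\<lambda>N. exp (- (\<kappa> * (r N * (real N)\<^sup>2)))) \<longlonglongrightarrow> 0"
      by (rule filterlim_compose[OF exp_at_bot])
  qed
qed

theorem corollary1p2: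
  fixes M :: "'w measure"
    and h :: "site \<Rightarrow> 'w \<Rightarrow> real"
    and T :: real
    and \<xi> :: "site \<Rightarrow> real"
  assumes "prob_space M"
    and "iid_std_normal M h"
    and "T > 0"
    and "\<And>x. \<xi> x \<in> {1, 0, -1}"
  shows "(\<forall>\<epsilon> :: nat \<Rightarrow> real.
            (\<forall>N\<ge>1. \<epsilon> N > 0) \<longrightarrow>
            (\<lambda>N. \<epsilon> N / inverse (real N)) \<longlonglongrightarrow> 0 \<longrightarrow>
            tendsto_in_prob M
              (\<lambda>N w. tv_dist (ising_measure T (lattice_box N) \<xi> (\<lambda>x. \<epsilon> N * h x w))
                             (ising_measure T (lattice_box N) \<xi> (\<lambda>_. 0))) 0) \<and>
         (\<forall>\<epsilon> :: nat \<Rightarrow> real.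
            (\<forall>N\<ge>1. \<epsilon> N > 0) \<longrightarrow>
            filterlim (\<lambda>N. \<epsilon> N / inverse (real N)) at_top sequentially \<longrightarrow>
            tendsto_in_prob M
              (\<lambda>N w. tv_dist (ising_measure T (lattice_box N) \<xi> (\<lambda>x. \<epsilon> N * h x w))
                             (ising_measure T (lattice_box N) \<xi> (\<lambda>_. 0))) 1)"
proof -
  have "\<bar>\<xi> v\<bar> \<le> 1" for v using assms(4)[of v] by auto
  then show ?thesis
    using small_field_limit[OF assms(1-3)] large_field_limit[OF assms(1-3)] by blast
qed

end
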